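(* Let $m\ge 1$ and let $K_{m,1}$ be the star graph with $m$ leaves, so that it has $n=m+1$ vertices. Let $x_1,\dots,x_m$ be the indeterminates associated with the leaves and $y$ the indeterminate associated with the center. Let $\mathcal{R}$ be a commutative ring containing the integers. For $k\in\{1,\dots,n-1\}$ put $$C_k=\Big\{\prod_{i\in\mathcal{I}}(x_i-2) : \mathcal{I}\subseteq\{1,\dots,m\},\ |\mathcal{I}|=k-1\Big\}$$ and $$D_k=\Big\{(2y-1)\prod_{i\in\mathcal{I}}(x_i-2) : \mathcal{I}\subseteq\{1,\dots,m\},\ |\mathcal{I}|=k-2\Big\}.$$ Then for every $k\in\{1,\dots,n-1\}$ the $k$-th distance ideal of $K_{m,1}$ over $\mathcal{R}$ is the ideal $\langle C_k\cup D_k\rangle$ of $\mathcal{R}[x_1,\dots,x_m,y]$.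
   Context: For a connected graph $G$ with vertex set $V$, let $d_G(u,v)$ be the number of edges in a shortest path from $u$ to $v$, let $D(G)$ be the distance matrix $(d_G(u,v))_{u,v\in V}$, let $X_G=\{x_u:u\in V\}$ be indeterminates, and let $D(G,X_G)=\mathrm{diag}(X_G)+D(G)$. For a commutative ring $\mathcal{R}$ and $1\le i\le |V|$, the $i$-th distance ideal $I_i^{\mathcal{R}}(G,X_G)\subseteq \mathcal{R}[X_G]$ is the ideal generated by all $i\times i$ minors of $D(G,X_G)$ (determinants of arbitrary $i\times i$ submatrices). The empty product is $1$; in particular $C_1=\{1\}$, and $D_1=\emptyset$. *)

theory Defs
  imports
    "HOL-Library.Poly_Mapping"
    "HOL-Algebra.Ideal"
    "Graph_Theory.Graph_Theory"
    "Jordan_Normal_Form.Determinant"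
begin

section \<open>Polynomial rings\<close>

text \<open>
  Polynomials with coefficients in \<open>'r\<close> are finitely supported functions on monomials, a monomial
  being a finitely supported exponent function; the multiplication of \<^theory>\<open>HOL-Library.Poly_Mapping\<close>
  is the convolution product.
\<close>

type_synonym ('v, 'r) mpoly = "('v \<Rightarrow>\<^sub>0 nat) \<Rightarrow>\<^sub>0 'r"

definition Var :: "'v \<Rightarrow> ('v, 'r::comm_ring_1) mpoly" where
  "Var v = Poly_Mapping.single (Poly_Mapping.single v 1) 1"

text \<open>
  The type \<open>('v, 'r) mpoly\<close> has an indeterminate for every element of \<open>'v\<close>. The polynomial ring
  over \<open>'r\<close> in the indeterminates indexed by a set \<open>V\<close> is its subring below; ideals are taken
  in that subring.
\<close>

definition mpoly_ring :: "'v set \<Rightarrow> ('v, 'r::comm_ring_1) mpoly ring" where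
  "mpoly_ring V =
    \<lparr>carrier = {p. \<forall>t\<in>Poly_Mapping.keys p. Poly_Mapping.keys t \<subseteq> V},
     monoid.mult = (*), one = 1, zero = 0, add = (+)\<rparr>"

lemma cring_mpoly_ring: "cring (mpoly_ring V :: ('v, 'r::comm_ring_1) mpoly ring)"
proof -
  let ?C = "{p :: ('v, 'r) mpoly. \<forall>t\<in>Poly_Mapping.keys p. Poly_Mapping.keys t \<subseteq> V}"
  have add: "p + q \<in> ?C" if "p \<in> ?C" "q \<in> ?C" for p q
    using that keys_add[of p q] by auto
  have mult: "p * q \<in> ?C" if "p \<in> ?C" "q \<in> ?C" for p q
  proof -
    have "Poly_Mapping.keys t \<subseteq> V" if t: "t \<in> Poly_Mapping.keys (p * q)" for t
    proof -
      obtain a b where ab: "t = a + b" "a \<in> Poly_Mapping.keys p" "b \<in> Poly_Mapping.keys q"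
        using keys_mult[of p q] t by blast
      then show ?thesis
        using \<open>p \<in> ?C\<close> \<open>q \<in> ?C\<close> keys_add[of a b] by fastforce
    qed
    then show ?thesis by blast
  qed
  have uminus: "- p \<in> ?C" if "p \<in> ?C" for p
    using that by (simp add: in_keys_iff)
  show ?thesis
  proof (rule cringI)
    show "abelian_group (mpoly_ring V :: ('v, 'r) mpoly ring)"
    proof (rule abelian_groupI)
      fix p :: "('v, 'r) mpoly" assume "p \<in> carrier (mpoly_ring V)"
      then have "- p \<in> carrier (mpoly_ring V)" using uminus by (simp add: mpoly_ring_def)
      then show "\<exists>q\<in>carrier (mpoly_ring V). q \<oplus>\<^bsub>mpoly_ring V\<^esub> p = \<zero>\<^bsub>mpoly_ring V\<^esub>"
        by (intro bexI[of _ "- p"]) (simp add: mpoly_ring_def)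
    next
      fix p q :: "('v, 'r) mpoly"
      assume "p \<in> carrier (mpoly_ring V)" "q \<in> carrier (mpoly_ring V)"
      then show "p \<oplus>\<^bsub>mpoly_ring V\<^esub> q \<in> carrier (mpoly_ring V)"
        using add[of p q] by (simp add: mpoly_ring_def)
    qed (simp_all add: mpoly_ring_def ac_simps)
    show "Group.comm_monoid (mpoly_ring V :: ('v, 'r) mpoly ring)"
    proof (rule comm_monoidI)
      fix p q :: "('v, 'r) mpoly"
      assume "p \<in> carrier (mpoly_ring V)" "q \<in> carrier (mpoly_ring V)"
      then show "p \<otimes>\<^bsub>mpoly_ring V\<^esub> q \<in> carrier (mpoly_ring V)"
        using mult[of p q] by (simp add: mpoly_ring_def)
    qed (simp_all add: mpoly_ring_def ac_simps)
  qed (simp add: mpoly_ring_def algebra_simps)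
qed

section \<open>Distance ideals\<close>

text \<open>
  As in \<^theory>\<open>Graph_Theory.Digraph\<close>, undirected graphs are symmetric digraphs, so that the arcs
  of a path correspond to the edges traversed. The value is meaningful only if \<open>v\<close> is reachable
  from \<open>u\<close>, which always holds in a connected graph.
\<close>

definition graph_dist :: "('v, 'e) pre_digraph \<Rightarrow> 'v \<Rightarrow> 'v \<Rightarrow> nat" where
  "graph_dist G u v = (LEAST n. \<exists>p. pre_digraph.apath G u p v \<and> length p = n)"

text \<open>
  The entries of \<open>diag(X\<^sub>G) + D(G)\<close>, with rows and columns indexed by vertices.
\<close>

definition gen_dist_matrix ::
  "('v, 'e) pre_digraph \<Rightarrow> 'v \<Rightarrow> 'v \<Rightarrow> ('v, 'r::comm_ring_1) mpoly" where
  "gen_dist_matrix G u v = (if u = v then Var u else 0) + of_nat (graph_dist G u v)"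

text \<open>
  A \<open>k \<times> k\<close> submatrix is selected by lists of \<open>k\<close> distinct row vertices and \<open>k\<close> distinct column
  vertices. Vertices carry no order, so all orderings of the selected rows and columns are
  admitted; reordering changes a minor only by a sign, hence does not affect the generated ideal.
\<close>

definition dist_minors ::
  "('v, 'e) pre_digraph \<Rightarrow> nat \<Rightarrow> ('v, 'r::comm_ring_1) mpoly set" where
  "dist_minors G k =
    {det (mat k k (\<lambda>(a, b). gen_dist_matrix G (rs ! a) (cs ! b))) | rs cs.
      distinct rs \<and> set rs \<subseteq> verts G \<and> length rs = k \<and>
      distinct cs \<and> set cs \<subseteq> verts G \<and> length cs = k}"

definition distance_ideal ::
  "('v, 'e) pre_digraph \<Rightarrow> nat \<Rightarrow> ('v, 'r::comm_ring_1) mpoly set" where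
  "distance_ideal G k = Idl\<^bsub>mpoly_ring (verts G)\<^esub> (dist_minors G k)"

section \<open>Generators for star graphs\<close>

definition star_C :: "nat \<Rightarrow> (nat \<Rightarrow> 'a::comm_ring_1) \<Rightarrow> nat \<Rightarrow> 'a set" where
  "star_C m x k = {\<Prod>i\<in>I. (x i - 2) | I. I \<subseteq> {1..m} \<and> card I + 1 = k}"

text \<open>
  The cardinality condition is written additively because \<open>k - 2\<close> is truncated on the natural
  numbers; in this form the set is empty for \<open>k = 1\<close>.
\<close>

definition star_D :: "nat \<Rightarrow> (nat \<Rightarrow> 'a::comm_ring_1) \<Rightarrow> 'a \<Rightarrow> nat \<Rightarrow> 'a set" where
  "star_D m x y k = {(2 * y - 1) * (\<Prod>i\<in>I. (x i - 2)) | I. I \<subseteq> {1..m} \<and> card I + 2 = k}"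

end

theory Submission
  imports Defs
begin

text \<open>
  The matrix has entries \<open>2 + a\<^sub>u\<close> on the diagonal of the leaves, where \<open>a\<^sub>u = x\<^sub>u - 2\<close>, and its
  other entries between leaves are \<open>2\<close>. By linearity in the row of \<open>u\<close>, a minor containing the
  row and the column of \<open>u\<close> is \<open>\<plusminus> a\<^sub>u\<close> times the minor with \<open>u\<close> deleted plus the same minor with
  \<open>a\<^sub>u\<close> replaced by \<open>0\<close>. Iterating this splits off the products of the \<open>a\<^sub>u\<close>; once all relevant
  \<open>a\<^sub>u\<close> vanish, the submatrix has rank at most two and its minor is an entry, zero, or
  \<open>\<plusminus> (2 y - 1)\<close>. Conversely, each generator is a minor for which the second summand
  always vanishes.
\<close>

section \<open>Minors with entries indexed by functions\<close>

text \<open>Rows and columns are selected by functions, so that deleting a row or a column is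
  composition with \<open>insert_index\<close>, the increasing enumeration of the indices that skips
  one value.\<close>

definition index_minor :: "('v \<Rightarrow> 'v \<Rightarrow> 'a::comm_ring_1) \<Rightarrow> nat \<Rightarrow> (nat \<Rightarrow> 'v) \<Rightarrow> (nat \<Rightarrow> 'v) \<Rightarrow> 'a" where
  "index_minor E k f g = det (mat k k (\<lambda>(i, j). E (f i) (g j)))"

lemma index_minor_cong:
  assumes "\<And>i j. i < k \<Longrightarrow> j < k \<Longrightarrow> E (f i) (g j) = E' (f' i) (g' j)"
  shows "index_minor E k f g = index_minor E' k f' g'"
  unfolding index_minor_def using assms by (intro arg_cong[of _ _ det] cong_mat) auto

lemma index_minor_1: "index_minor E (Suc 0) f g = E (f 0) (g 0)"
  unfolding index_minor_def by (subst det_single) auto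

lemma insert_index_less: "i < k - 1 \<Longrightarrow> insert_index i0 i < k"
  by (auto simp: insert_index_def)

lemma insert_index_neq: "insert_index i0 i \<noteq> i0"
  by (auto simp: insert_index_def)

lemma inj_insert_index: "inj (insert_index i0)"
  by (metis delete_insert_index injI)

lemma inj_on_comp_insert_index:
  assumes "inj_on f {..<k}"
  shows "inj_on (f \<circ> insert_index i0) {..<k - 1}"
proof (rule comp_inj_on)
  show "inj_on (insert_index i0) {..<k - 1}"
    using inj_insert_index by (rule inj_on_subset) simp
  show "inj_on f (insert_index i0 ` {..<k - 1})"
    using assms by (rule inj_on_subset) (auto simp: insert_index_less)
qed

text \<open>Injectivity makes the deletion of one position remove its vertex from the selection
  altogether. Hence the deleted minor avoids the vertex that was split off.\<close>

lemma image_comp_insert_index: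
  assumes "inj_on f {..<k}" "i0 < k"
  shows "(f \<circ> insert_index i0) ` {..<k - 1} \<subseteq> f ` {..<k} - {f i0}"
proof (rule image_subsetI)
  fix i assume "i \<in> {..<k - 1}"
  then have "insert_index i0 i < k" by (simp add: insert_index_less)
  then show "(f \<circ> insert_index i0) i \<in> f ` {..<k} - {f i0}"
    using inj_onD[OF assms(1), of "insert_index i0 i" i0] assms(2) insert_index_neq by auto
qed

lemma index_minor_laplace:
  assumes "i0 < k"
  shows "index_minor E k f g = (\<Sum>j<k. E (f i0) (g j) *
    ((-1) ^ (i0 + j) * index_minor E (k - 1) (f \<circ> insert_index i0) (g \<circ> insert_index j)))"
proof -
  let ?M = "mat k k (\<lambda>(i, j). E (f i) (g j))"
  have "mat_delete ?M i0 j
      = mat (k - 1) (k - 1) (\<lambda>(i, l). E ((f \<circ> insert_index i0) i) ((g \<circ> insert_index j) l))" for j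
    unfolding mat_delete_def using insert_index_less
    by (intro eq_matI) (auto simp: insert_index_def)
  then have "cofactor ?M i0 j = (-1) ^ (i0 + j) *
      index_minor E (k - 1) (f \<circ> insert_index i0) (g \<circ> insert_index j)" for j
    by (simp add: cofactor_def index_minor_def)
  moreover have "index_minor E k f g = (\<Sum>j<k. ?M $$ (i0, j) * cofactor ?M i0 j)"
    unfolding index_minor_def using assms by (intro laplace_expansion_row) auto
  ultimately show ?thesis
    using assms by (auto intro!: sum.cong)
qed

text \<open>Expand both minors along row \<open>i0\<close>. The cofactors agree because the
  remaining rows avoid \<open>r\<close>, the only place where \<open>E\<close> and \<open>E'\<close>
  may differ. By injectivity of \<open>g\<close>, the coefficients differ at most in column
  \<open>j0\<close>, so the difference of the minors is a single term.\<close>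

lemma index_minor_perturb:
  assumes f: "inj_on f {..<k}" and g: "inj_on g {..<k}"
    and i0: "i0 < k" "f i0 = r" and j0: "j0 < k" "g j0 = r"
    and E': "\<And>u v. u \<noteq> r \<or> v \<noteq> r \<Longrightarrow> E' u v = E u v"
  shows "index_minor E k f g = (E r r - E' r r) * ((-1) ^ (i0 + j0) *
      index_minor E (k - 1) (f \<circ> insert_index i0) (g \<circ> insert_index j0)) + index_minor E' k f g"
proof -
  let ?m = "\<lambda>E j. (-1) ^ (i0 + j) *
      index_minor E (k - 1) (f \<circ> insert_index i0) (g \<circ> insert_index j)"
  have neq: "(f \<circ> insert_index i0) i \<noteq> r" if "i < k - 1" for i
    using image_comp_insert_index[OF f i0(1)] i0(2) that by blast
  have m: "?m E' j = ?m E j" for j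
    by (intro arg_cong2[of _ _ _ _ "(*)"] refl index_minor_cong E') (use neq in blast)
  have "index_minor E k f g - index_minor E' k f g
      = (\<Sum>j<k. E r (g j) * ?m E j) - (\<Sum>j<k. E' r (g j) * ?m E' j)"
    using index_minor_laplace[OF i0(1), of E f g] index_minor_laplace[OF i0(1), of E' f g] i0(2)
    by simp
  also have "\<dots> = (\<Sum>j<k. (E r (g j) - E' r (g j)) * ?m E j)"
    unfolding m by (simp add: sum_subtractf left_diff_distrib)
  also have "\<dots> = (\<Sum>j<k. if j = j0 then (E r r - E' r r) * ?m E j else 0)"
  proof (intro sum.cong refl)
    fix j assume "j \<in> {..<k}"
    then have "g j \<noteq> r" if "j \<noteq> j0"
      using that inj_onD[OF g, of j j0] j0 by auto
    then show "(E r (g j) - E' r (g j)) * ?m E j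
        = (if j = j0 then (E r r - E' r r) * ?m E j else 0)"
      using j0 E'[of r "g j"] by auto
  qed
  also have "\<dots> = (E r r - E' r r) * ?m E j0"
    using j0 by simp
  finally show ?thesis by (simp add: algebra_simps)
qed

lemma index_minor_equal_rows:
  assumes "i < k" "i' < k" "i \<noteq> i'" "\<And>j. j < k \<Longrightarrow> E (f i) (g j) = E (f i') (g j)"
  shows "index_minor E k f g = 0"
  unfolding index_minor_def using assms
  by (intro det_identical_rows[of _ k i i']) (auto intro!: eq_vecI)

lemma index_minor_equal_cols:
  assumes "j < k" "j' < k" "j \<noteq> j'" "\<And>i. i < k \<Longrightarrow> E (f i) (g j) = E (f i) (g j')"
  shows "index_minor E k f g = 0"
  unfolding index_minor_def using assms
  by (intro det_identical_columns[of _ k j j']) (auto intro!: eq_vecI)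

lemma index_minor_2:
  "index_minor E 2 f g = E (f 0) (g 0) * E (f 1) (g 1) - E (f 0) (g 1) * E (f 1) (g 0)"
  by (subst index_minor_laplace[of 0])
    (simp_all add: eval_nat_numeral index_minor_1 insert_index_def)

section \<open>Minors of star-shaped matrices\<close>

text \<open>With \<open>a u\<close> equal to the indeterminate of \<open>u\<close> minus 2, this is
  the matrix diag(X) + D of the star with center \<open>c\<close>. Keeping \<open>a\<close> as an
  arbitrary function allows its values to be set to zero one at a time.\<close>

definition star_entry :: "'v \<Rightarrow> ('v \<Rightarrow> 'a::comm_ring_1) \<Rightarrow> 'a \<Rightarrow> 'v \<Rightarrow> 'v \<Rightarrow> 'a" where
  "star_entry c a y u v =
    (if u = c \<and> v = c then y else if u = c \<or> v = c then 1 else 2 + (if u = v then a u else 0))"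

text \<open>Setting \<open>a r\<close> to zero changes only the diagonal entry of the leaf
  \<open>r\<close>, and changes it by \<open>a r\<close>.\<close>

lemma index_minor_star_step:
  assumes "inj_on f {..<k}" "inj_on g {..<k}"
    and "i0 < k" "f i0 = r" "j0 < k" "g j0 = r" "r \<noteq> c"
  shows "index_minor (star_entry c a y) k f g = a r * ((-1) ^ (i0 + j0) *
      index_minor (star_entry c a y) (k - 1) (f \<circ> insert_index i0) (g \<circ> insert_index j0))
    + index_minor (star_entry c (a(r := 0)) y) k f g"
proof -
  have "star_entry c (a(r := 0)) y u v = star_entry c a y u v" if "u \<noteq> r \<or> v \<noteq> r" for u v
    using that by (auto simp: star_entry_def)
  from index_minor_perturb[OF assms(1-6), of "star_entry c (a(r := 0)) y" "star_entry c a y", OF this]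
  have "index_minor (star_entry c a y) k f g
      = (star_entry c a y r r - star_entry c (a(r := 0)) y r r) * ((-1) ^ (i0 + j0) *
        index_minor (star_entry c a y) (k - 1) (f \<circ> insert_index i0) (g \<circ> insert_index j0))
      + index_minor (star_entry c (a(r := 0)) y) k f g" by blast
  then show ?thesis using assms(7) by (simp add: star_entry_def)
qed

text \<open>
  With a vanishing diagonal part the matrix has only two types of rows and columns, so only
  minors of size at most two survive.
\<close>

lemma index_minor_star_zero:
  assumes f: "inj_on f {..<k}" and g: "inj_on g {..<k}" and k: "k \<ge> 2"
    and a: "\<And>r. r \<in> f ` {..<k} \<inter> g ` {..<k} - {c} \<Longrightarrow> a r = 0"
  shows "index_minor (star_entry c a y) k f g = 0 \<or>
    k = 2 \<and> index_minor (star_entry c a y) k f g \<in> {2 * y - 1, - (2 * y - 1)}"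
proof -
  let ?d = "index_minor (star_entry c a y) k f g"
  have entry: "star_entry c a y (f i) (g j)
      = (if f i = c \<and> g j = c then y else if f i = c \<or> g j = c then 1 else 2)"
    if "i < k" "j < k" for i j
  proof -
    have "a (f i) = 0" if "f i = g j" "f i \<noteq> c"
      using that \<open>i < k\<close> \<open>j < k\<close> by (intro a) (auto intro: rev_image_eqI)
    then show ?thesis by (auto simp: star_entry_def)
  qed
  show ?thesis
  proof (cases "?d = 0")
    case False
    \<comment> \<open>All non-central rows of the submatrix are equal: 1 in a central column and 2
      elsewhere. A nonzero minor thus has at most one of them. The same holds for columns.\<close>
    have rows: "f i = c \<or> f i' = c" if "i < k" "i' < k" "i \<noteq> i'" for i i'
    proof (rule ccontr)
      assume "\<not> (f i = c \<or> f i' = c)"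
      then have "?d = 0"
        using that by (intro index_minor_equal_rows[OF that]) (simp add: entry)
      with False show False by blast
    qed
    have cols: "g i = c \<or> g i' = c" if "i < k" "i' < k" "i \<noteq> i'" for i i'
    proof (rule ccontr)
      assume "\<not> (g i = c \<or> g i' = c)"
      then have "?d = 0"
        using that by (intro index_minor_equal_cols[OF that]) (simp add: entry)
      with False show False by blast
    qed
    \<comment> \<open>Among three positions, two would have to carry \<open>c\<close>, against
      injectivity.\<close>
    have "k = 2"
    proof (rule ccontr)
      assume "k \<noteq> 2"
      with k have "0 < k" "1 < k" "2 < k" by auto
      with rows[of 0 1] rows[of 0 2] rows[of 1 2] show False
        using inj_onD[OF f, of 0 1] inj_onD[OF f, of 0 2] inj_onD[OF f, of 1 2] by auto
    qed
    \<comment> \<open>Both selections contain \<open>c\<close> exactly once. The minor is that of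
      the rows (y, 1) and (1, 2), up to a swap if \<open>c\<close> stands at different positions in
      the two selections; this accounts for the sign.\<close>
    moreover have "f 0 = c \<longleftrightarrow> f 1 \<noteq> c" "g 0 = c \<longleftrightarrow> g 1 \<noteq> c"
      using rows[of 0 1] cols[of 0 1] inj_onD[OF f, of 0 1] inj_onD[OF g, of 0 1] \<open>k = 2\<close> by auto
    ultimately show ?thesis
      by (auto simp: index_minor_2 entry)
  qed auto
qed

text \<open>\<open>J\<close> plays the ideal and \<open>S\<close> a set of admissible multipliers;
  \<open>p\<close> collects the factors \<open>a r\<close> already split off. The induction is on
  \<open>B\<close>, which bounds the leaves common to rows and columns where \<open>a\<close> is
  nonzero. Both summands of \<open>index_minor_star_step\<close> have a smaller \<open>B\<close>:
  one deletes \<open>r\<close>, the other has \<open>a r\<close> set to zero. \<open>C\<close> and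
  \<open>D\<close> put \<open>p\<close> times each generator into \<open>J\<close>, and
  \<open>aS\<close> handles single entries.\<close>

lemma mult_index_minor_star_mem:
  fixes a :: "'v \<Rightarrow> 'a::comm_ring_1"
  assumes zero: "0 \<in> J" and add: "\<And>p q. p \<in> J \<Longrightarrow> q \<in> J \<Longrightarrow> p + q \<in> J"
    and mult: "\<And>p q. p \<in> S \<Longrightarrow> q \<in> J \<Longrightarrow> p * q \<in> J"
    and S: "1 \<in> S" "-1 \<in> S" "2 \<in> S" "y \<in> S"
    and fin: "finite B"
    and f: "inj_on f {..<k}" and g: "inj_on g {..<k}" and k: "k \<ge> 1"
    and aS: "\<And>r. r \<in> f ` {..<k} \<inter> g ` {..<k} - {c} \<Longrightarrow> 2 + a r \<in> S"
    and B: "\<And>r. r \<in> f ` {..<k} \<inter> g ` {..<k} - {c} \<Longrightarrow> a r \<noteq> 0 \<Longrightarrow> r \<in> B"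
    and C: "\<And>I. I \<subseteq> f ` {..<k} \<inter> g ` {..<k} - {c} \<Longrightarrow> card I + 1 = k \<Longrightarrow> p * (\<Prod>i\<in>I. a i) \<in> J"
    and D: "\<And>I. I \<subseteq> f ` {..<k} \<inter> g ` {..<k} - {c} \<Longrightarrow> card I + 2 = k \<Longrightarrow>
      p * ((2 * y - 1) * (\<Prod>i\<in>I. a i)) \<in> J"
  shows "p * index_minor (star_entry c a y) k f g \<in> J"
proof -
  have singleton: "p * index_minor E (Suc 0) f g \<in> J" if "E (f 0) (g 0) \<in> S" "p \<in> J"
    for p E and f g :: "nat \<Rightarrow> 'v"
    using mult[OF that] by (simp add: index_minor_1 mult.commute)
  show ?thesis
    using fin f g k aS B C D
  proof (induction B arbitrary: k f g a p rule: finite_induct)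
    case empty
    have uminus: "- q \<in> J" if "q \<in> J" for q
      using mult[OF S(2) that] by simp
    show ?case
    proof (cases "k = 1")
      case True
      have "star_entry c a y (f 0) (g 0) \<in> S"
        using S empty.prems(4)[of "f 0"] True by (auto simp: star_entry_def)
      \<comment> \<open>For size 1, the only set allowed in \<open>C\<close> is empty, with product
        1.\<close>
      moreover have "p \<in> J"
        using empty.prems(6)[of "{}"] True by simp
      ultimately show ?thesis
        using singleton True by simp
    next
      case False
      then have "k \<ge> 2" using empty.prems(3) by simp
      define e where "e = 2 * y - 1"
      from index_minor_star_zero[OF empty.prems(1,2) \<open>k \<ge> 2\<close>, of c a y] empty.prems(5)
      have "index_minor (star_entry c a y) k f g = 0 \<or>
        k = 2 \<and> index_minor (star_entry c a y) k f g \<in> {e, - e}"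
        unfolding e_def by blast
      moreover have "p * e \<in> J" if "k = 2"
        using empty.prems(7)[of "{}"] that by (simp add: e_def)
      ultimately show ?thesis
        using zero uminus[of "p * e"] by auto
    qed
  next
    case (insert r B)
    let ?A = "f ` {..<k} \<inter> g ` {..<k} - {c}"
    show ?case
    \<comment> \<open>Splitting at \<open>r\<close> requires that it label both a row and a column.
      If it does not, the hypotheses already hold for the smaller \<open>B\<close>. Size 1 is
      treated as a single entry, since deletion would leave the empty minor, outside the assumption
      \<open>k \<ge> 1\<close>.\<close>
    proof (cases "r \<in> ?A \<and> k \<noteq> 1")
      case False
      show ?thesis
      proof (cases "k = 1")
        case True
        have "star_entry c a y (f 0) (g 0) \<in> S"
          using S insert.prems(4)[of "f 0"] True by (auto simp: star_entry_def)
        moreover have "p \<in> J"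
          using insert.prems(6)[of "{}"] True by simp
        ultimately show ?thesis
          using singleton True by simp
      next
        case False
        with \<open>\<not> (r \<in> ?A \<and> k \<noteq> 1)\<close> have "r \<notin> ?A" by blast
        then show ?thesis
          using insert.prems by (intro insert.IH) blast+
      qed
    next
      case True
      then obtain i0 j0 where ij: "i0 < k" "f i0 = r" "j0 < k" "g j0 = r" and "r \<noteq> c" by auto
      let ?f = "f \<circ> insert_index i0" and ?g = "g \<circ> insert_index j0"
      let ?A' = "?f ` {..<k - 1} \<inter> ?g ` {..<k - 1} - {c}"
      have A': "?A' \<subseteq> ?A - {r}"
        using image_comp_insert_index[OF insert.prems(1) ij(1)]
          image_comp_insert_index[OF insert.prems(2) ij(3)] ij(2,4) by blast
      \<comment> \<open>Adding \<open>r\<close> to a set \<open>I\<close> of the deleted minor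
        absorbs the factor \<open>a r\<close> and raises the cardinality by one. So \<open>C\<close>
        and \<open>D\<close> for size \<open>k\<close> yield those for size \<open>k - 1\<close>
        with \<open>p * a r\<close> in place of \<open>p\<close>.\<close>
      have extend: "a r * (\<Prod>i\<in>I. a i) = (\<Prod>i\<in>insert r I. a i)" "card (insert r I) = card I + 1"
        "insert r I \<subseteq> ?A" if "I \<subseteq> ?A'" for I
      proof -
        have "finite I" "r \<notin> I"
          using that A' finite_subset[OF that] by auto
        then show "a r * (\<Prod>i\<in>I. a i) = (\<Prod>i\<in>insert r I. a i)"
          "card (insert r I) = card I + 1" by auto
        show "insert r I \<subseteq> ?A" using that A' True by blast
      qed
      have minor: "(p * a r) * index_minor (star_entry c a y) (k - 1) ?f ?g \<in> J"
      proof (rule insert.IH)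
        show "inj_on ?f {..<k - 1}" "inj_on ?g {..<k - 1}"
          by (fact inj_on_comp_insert_index[OF insert.prems(1)] inj_on_comp_insert_index[OF insert.prems(2)])+
        show "1 \<le> k - 1" using True insert.prems(3) by linarith
        show "2 + a s \<in> S" if "s \<in> ?A'" for s
          using that A' insert.prems(4) by blast
        show "s \<in> B" if "s \<in> ?A'" "a s \<noteq> 0" for s
          using that A' insert.prems(5) by blast
        show "p * a r * (\<Prod>i\<in>I. a i) \<in> J" if "I \<subseteq> ?A'" "card I + 1 = k - 1" for I
          using insert.prems(6)[OF extend(3)[OF that(1)]] extend(1,2)[OF that(1)] that(2)
          by (simp add: mult.assoc)
        show "p * a r * ((2 * y - 1) * (\<Prod>i\<in>I. a i)) \<in> J" if "I \<subseteq> ?A'" "card I + 2 = k - 1" for I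
          using insert.prems(7)[OF extend(3)[OF that(1)]] extend(1,2)[OF that(1), symmetric] that(2)
          by (simp add: mult_ac)
      qed
      have rest: "p * index_minor (star_entry c (a(r := 0)) y) k f g \<in> J"
      proof (rule insert.IH)
        \<comment> \<open>After zeroing \<open>a r\<close>, each product is either unchanged or
          zero, so \<open>C\<close> and \<open>D\<close> are inherited because
          \<open>0 \<in> J\<close>.\<close>
        have prod0: "(\<Prod>i\<in>I. (a(r := 0)) i) = (if r \<in> I then 0 else \<Prod>i\<in>I. a i)"
          if "I \<subseteq> ?A" for I
        proof -
          have "finite I" using that by (rule finite_subset) simp
          then show ?thesis by (auto intro!: prod.cong prod_zero)
        qed
        show "2 + (a(r := 0)) s \<in> S" if "s \<in> ?A" for s
          using that insert.prems(4) S by simp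
        show "s \<in> B" if "s \<in> ?A" "(a(r := 0)) s \<noteq> 0" for s
          using that insert.prems(5)[of s] by (auto split: if_splits)
        show "p * (\<Prod>i\<in>I. (a(r := 0)) i) \<in> J" if "I \<subseteq> ?A" "card I + 1 = k" for I
          using insert.prems(6)[OF that] zero unfolding prod0[OF that(1)] by auto
        show "p * ((2 * y - 1) * (\<Prod>i\<in>I. (a(r := 0)) i)) \<in> J" if "I \<subseteq> ?A" "card I + 2 = k" for I
          using insert.prems(7)[OF that] zero unfolding prod0[OF that(1)] by auto
      qed (use insert.prems in auto)
      have "(-1) ^ (i0 + j0) \<in> S"
        using S by (cases "even (i0 + j0)") auto
      from add[OF mult[OF this minor] rest]
      show ?thesis
        unfolding index_minor_star_step[OF insert.prems(1,2) ij \<open>r \<noteq> c\<close>, of a y]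
        by (simp only: distrib_left mult_ac)
    qed
  qed
qed

text \<open>
  In the two minors below, zeroing \<open>a r\<close> makes two columns, respectively two rows, equal, so
  that only the deleted minor remains in the expansion.
\<close>

lemma index_minor_star_C:
  assumes "distinct (xs @ [c, l])"
  shows "index_minor (star_entry c a y) (Suc (length xs)) ((!) (xs @ [c])) ((!) (xs @ [l]))
    = (\<Prod>i\<in>set xs. a i)"
  using assms
proof (induction xs)
  case Nil
  then show ?case by (simp add: index_minor_1 star_entry_def)
next
  case (Cons r xs)
  let ?k = "Suc (length (r # xs))"
  let ?f = "(!) ((r # xs) @ [c])" and ?g = "(!) ((r # xs) @ [l])"
  \<comment> \<open>The columns of \<open>r\<close> and \<open>l\<close> agree: \<open>l\<close> is
    not a row, and the diagonal entry of \<open>r\<close> has become 2.\<close>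
  have "index_minor (star_entry c (a(r := 0)) y) ?k ?f ?g = 0"
  proof (rule index_minor_equal_cols[of 0 _ "length (r # xs)"])
    fix i assume "i < ?k"
    then have "?f i \<in> set ((r # xs) @ [c])" by (intro nth_mem) simp
    then have "?f i \<noteq> l" using Cons.prems by auto
    then show "star_entry c (a(r := 0)) y (?f i) (?g 0)
        = star_entry c (a(r := 0)) y (?f i) (?g (length (r # xs)))"
      using Cons.prems by (auto simp: star_entry_def nth_append)
  qed auto
  moreover have "?f \<circ> insert_index 0 = (!) (xs @ [c])" "?g \<circ> insert_index 0 = (!) (xs @ [l])"
    by (auto simp: insert_index_def)
  moreover have "inj_on ?f {..<?k}" "inj_on ?g {..<?k}"
    using Cons.prems by (auto intro!: inj_on_nth simp del: append_Cons)
  ultimately show ?case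
    using index_minor_star_step[of ?f ?k ?g 0 r 0 c a y] Cons by auto
qed

lemma index_minor_star_D:
  assumes "distinct (xs @ [c, l, l'])"
  shows "index_minor (star_entry c a y) (length xs + 2) ((!) (xs @ [c, l])) ((!) (xs @ [c, l']))
    = (2 * y - 1) * (\<Prod>i\<in>set xs. a i)"
  using assms
proof (induction xs)
  case Nil
  then show ?case
    using index_minor_2[of "star_entry c a y" "(!) [c, l]" "(!) [c, l']"]
    by (auto simp: star_entry_def[of _ _ _ c] star_entry_def[of _ _ _ l] numeral_2_eq_2 mult.commute)
next
  case (Cons r xs)
  let ?k = "length (r # xs) + 2"
  let ?f = "(!) ((r # xs) @ [c, l])" and ?g = "(!) ((r # xs) @ [c, l'])"
  \<comment> \<open>Here the rows of \<open>r\<close> and \<open>l\<close> agree, since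
    \<open>l\<close> is not a column.\<close>
  have "index_minor (star_entry c (a(r := 0)) y) ?k ?f ?g = 0"
  proof (rule index_minor_equal_rows[of 0 _ "Suc (length (r # xs))"])
    fix j assume "j < ?k"
    then have "?g j \<in> set ((r # xs) @ [c, l'])" by (intro nth_mem) simp
    then have "?g j \<noteq> l" using Cons.prems by auto
    then show "star_entry c (a(r := 0)) y (?f 0) (?g j)
        = star_entry c (a(r := 0)) y (?f (Suc (length (r # xs)))) (?g j)"
      using Cons.prems by (auto simp: star_entry_def nth_append)
  qed auto
  moreover have "?f \<circ> insert_index 0 = (!) (xs @ [c, l])" "?g \<circ> insert_index 0 = (!) (xs @ [c, l'])"
    by (auto simp: insert_index_def)
  moreover have "inj_on ?f {..<?k}" "inj_on ?g {..<?k}"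
    using Cons.prems by (auto intro!: inj_on_nth simp del: append_Cons)
  ultimately show ?case
    using index_minor_star_step[of ?f ?k ?g 0 r 0 c a y] Cons by (auto simp: mult_ac)
qed

section \<open>Distances in the star\<close>

lemma graph_dist_self: "u \<in> verts G \<Longrightarrow> graph_dist G u u = 0"
  unfolding graph_dist_def
  by (rule Least_equality) (auto simp: pre_digraph.apath_def pre_digraph.awalk_def
    pre_digraph.awalk_verts.simps pre_digraph.cas.simps)

lemma (in wf_digraph) graph_dist_adjacent:
  assumes "u \<rightarrow> v" "u \<noteq> v"
  shows "graph_dist G u v = 1"
  unfolding graph_dist_def
proof (rule Least_equality)
  obtain e where "e \<in> arcs G" "tail G e = u" "head G e = v" using assms(1) by auto
  then show "\<exists>p. apath u p v \<and> length p = 1"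
    using assms(2) by (intro exI[of _ "[e]"]) (auto simp: apath_simps)
qed (use assms in \<open>auto simp: apath_simps Suc_le_eq\<close>)

lemma (in wf_digraph) graph_dist_common_neighbour:
  assumes "u \<rightarrow> w" "w \<rightarrow> v" "u \<noteq> w" "w \<noteq> v" "u \<noteq> v" "\<not> u \<rightarrow> v"
  shows "graph_dist G u v = 2"
  unfolding graph_dist_def
proof (rule Least_equality)
  obtain e e' where "e \<in> arcs G" "tail G e = u" "head G e = w"
    "e' \<in> arcs G" "tail G e' = w" "head G e' = v" using assms(1,2) by (meson reachableE)
  then show "\<exists>p. apath u p v \<and> length p = 2"
    using assms by (intro exI[of _ "[e, e']"]) (auto simp: apath_simps)
next
  fix n assume "\<exists>p. apath u p v \<and> length p = n"
  then obtain p where p: "apath u p v" "length p = n" by blast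
  show "2 \<le> n"
  proof (rule ccontr)
    assume "\<not> 2 \<le> n"
    with p(2) consider "p = []" | e where "p = [e]"
      by (cases p; cases "tl p") auto
    then show False
      using p(1) assms(5,6) by cases (auto simp: apath_simps arcs_ends_conv)
  qed
qed

text \<open>The center is described by its adjacency to all other vertices rather than as the
  singleton part: for \<open>m = 1\<close> either vertex qualifies, and the proof never identifies
  \<open>c\<close> with the element of that part.\<close>

lemma complete_bipartite_star_dist:
  fixes G :: "('v, 'e) pre_digraph"
  assumes K: "K\<^bsub>m,1\<^esub> G" and c: "c \<in> verts G"
    and adj: "\<And>v. v \<in> verts G - {c} \<Longrightarrow> c \<rightarrow>\<^bsub>G\<^esub> v"
    and u: "u \<in> verts G" and v: "v \<in> verts G"
  shows "graph_dist G u v = (if u = v then 0 else if u = c \<or> v = c then 1 else 2)"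
proof -
  from K obtain U V where G: "graph G" and UV: "U \<inter> V = {}" "card V = 1"
    "arcs_ends G = U \<times> V \<union> V \<times> U"
    unfolding complete_bipartite_digraph_def by blast
  interpret graph G by (rule G)
  obtain w where w: "V = {w}" using UV(2) by (auto simp: card_1_singleton_iff)
  have sym: "s \<rightarrow>\<^bsub>G\<^esub> c" if "s \<in> verts G - {c}" for s
    using adj[OF that] sym_arcs arcs_ends_symmetric by metis
  consider "u = v" | "u \<noteq> v" "u = c \<or> v = c" | "u \<noteq> v" "u \<noteq> c" "v \<noteq> c" by blast
  then show ?thesis
  proof cases
    case 3
    \<comment> \<open>An edge between two leaves would form a triangle with \<open>c\<close>,
      impossible in a bipartite graph.\<close>
    have "\<not> u \<rightarrow>\<^bsub>G\<^esub> v"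
      using adj[of u] adj[of v] 3 u v UV(1) unfolding UV(3) w by auto
    then show ?thesis
      using graph_dist_common_neighbour[of u c v] adj[of v] sym[of u] 3 u v by auto
  qed (use graph_dist_self graph_dist_adjacent adj sym u v in auto)
qed

section \<open>Distance ideals of the star\<close>

lemma mpoly_ring_simps [simp]:
  "monoid.mult (mpoly_ring V) = (*)" "one (mpoly_ring V) = 1"
  "ring.zero (mpoly_ring V) = 0" "ring.add (mpoly_ring V) = (+)"
  by (simp_all add: mpoly_ring_def)

lemma Var_in_mpoly_ring: "v \<in> V \<Longrightarrow> Var v \<in> carrier (mpoly_ring V)"
  by (auto simp: mpoly_ring_def Var_def)

lemma uminus_in_mpoly_ring: "p \<in> carrier (mpoly_ring V) \<Longrightarrow> - p \<in> carrier (mpoly_ring V)"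
  by (auto simp: mpoly_ring_def in_keys_iff)

theorem theorem17:
  fixes G :: "('v, 'e) pre_digraph"
    and m n k :: nat
    and leaf :: "nat \<Rightarrow> 'v"
    and center :: 'v
    and x :: "nat \<Rightarrow> ('v, 'r::{comm_ring_1, ring_char_0}) mpoly"
    and y :: "('v, 'r) mpoly"
  assumes "m \<ge> 1"
    and "n = m + 1"
    and "K\<^bsub>m,1\<^esub> G"
    and "center \<in> verts G"
    and "bij_betw leaf {1..m} (verts G - {center})"
    and "\<forall>i\<in>{1..m}. center \<rightarrow>\<^bsub>G\<^esub> leaf i"
    and "\<forall>i\<in>{1..m}. x i = Var (leaf i)"
    and "y = Var center"
    and "k \<in> {1..n - 1}"
  shows "distance_ideal G k = Idl\<^bsub>mpoly_ring (verts G)\<^esub> (star_C m x k \<union> star_D m x y k)"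
proof -
  define a :: "'v \<Rightarrow> ('v, 'r) mpoly" where "a u = Var u - 2" for u
  let ?V = "verts G" and ?E = "star_entry center a y"
  let ?L = "?V - {center}"
  let ?R = "mpoly_ring ?V :: ('v, 'r) mpoly ring"
  let ?gens = "star_C m x k \<union> star_D m x y k"
  let ?minors = "dist_minors G k :: ('v, 'r) mpoly set"
  interpret R: cring ?R by (rule cring_mpoly_ring)
  have leaf_image: "leaf ` {1..m} = ?L" and inj: "inj_on leaf {1..m}"
    using assms(5) by (auto simp: bij_betw_def)
  have card_L: "card ?L = m"
    using bij_betw_same_card[OF assms(5)] by simp
  have k: "1 \<le> k" "k \<le> m" using assms(2,9) by auto
  have "finite ?L" using leaf_image by (metis finite_atLeastAtMost finite_imageI)

  have adj: "center \<rightarrow>\<^bsub>G\<^esub> v" if "v \<in> ?L" for v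
    using that leaf_image assms(6) by (metis imageE)
  have entry: "gen_dist_matrix G u v = ?E u v" if "u \<in> ?V" "v \<in> ?V" for u v
    using complete_bipartite_star_dist[OF assms(3,4) adj that] assms(8)
    by (auto simp: gen_dist_matrix_def star_entry_def a_def)
  have minor: "det (mat k k (\<lambda>(i, j). gen_dist_matrix G (rs ! i) (cs ! j)))
      = index_minor ?E k ((!) rs) ((!) cs)"
    if "set rs \<subseteq> ?V" "length rs = k" "set cs \<subseteq> ?V" "length cs = k" for rs cs
    unfolding index_minor_def using that nth_mem
    by (intro arg_cong[of _ _ det] cong_mat) (auto intro!: entry)

  \<comment> \<open>The generators reindexed by sets of leaf vertices instead of sets of
    numbers\<close>
  have prod_leaf: "(\<Prod>i\<in>I. x i - 2) = (\<Prod>u\<in>leaf ` I. a u)" "card (leaf ` I) = card I"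
    "leaf ` I \<subseteq> ?L" if "I \<subseteq> {1..m}" for I
  proof -
    have injI: "inj_on leaf I" using inj that by (rule inj_on_subset)
    show "(\<Prod>i\<in>I. x i - 2) = (\<Prod>u\<in>leaf ` I. a u)"
      unfolding prod.reindex[OF injI] using that assms(7) by (intro prod.cong) (auto simp: a_def)
    show "card (leaf ` I) = card I" using injI by (rule card_image)
    show "leaf ` I \<subseteq> ?L" using that leaf_image by blast
  qed
  have C_eq: "star_C m x k = {\<Prod>u\<in>I. a u | I. I \<subseteq> ?L \<and> card I + 1 = k}" (is "_ = ?C")
  proof (intro equalityI subsetI)
    fix p assume "p \<in> star_C m x k"
    then show "p \<in> ?C" unfolding star_C_def using prod_leaf by (smt (verit) mem_Collect_eq)
  next
    fix p assume "p \<in> ?C"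
    then obtain I where "p = (\<Prod>u\<in>leaf ` I. a u)" "I \<subseteq> {1..m}" "card (leaf ` I) + 1 = k"
      unfolding leaf_image[symmetric] by (auto simp: subset_image_iff)
    then show "p \<in> star_C m x k" unfolding star_C_def using prod_leaf(1,2)[of I]
      by (intro CollectI exI[of _ I]) simp
  qed
  have D_eq: "star_D m x y k = {(2 * y - 1) * (\<Prod>u\<in>I. a u) | I. I \<subseteq> ?L \<and> card I + 2 = k}"
    (is "_ = ?D")
  proof (intro equalityI subsetI)
    fix p assume "p \<in> star_D m x y k"
    then show "p \<in> ?D" unfolding star_D_def using prod_leaf by (smt (verit) mem_Collect_eq)
  next
    fix p assume "p \<in> ?D"
    then obtain I where "p = (2 * y - 1) * (\<Prod>u\<in>leaf ` I. a u)" "I \<subseteq> {1..m}"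
      "card (leaf ` I) + 2 = k"
      unfolding leaf_image[symmetric] by (auto simp: subset_image_iff)
    then show "p \<in> star_D m x y k" unfolding star_D_def using prod_leaf(1,2)[of I]
      by (intro CollectI exI[of _ I]) simp
  qed

  \<comment> \<open>Membership in the polynomial ring over the vertices, where the ideals are
    taken\<close>
  have one: "1 \<in> carrier ?R" using R.one_closed by simp
  have m1: "-1 \<in> carrier ?R" using uminus_in_mpoly_ring[OF one] .
  have two: "2 \<in> carrier ?R" using R.a_closed[OF one one] by simp
  have y_in: "y \<in> carrier ?R" using assms(4,8) Var_in_mpoly_ring by auto
  have a_in: "a u \<in> carrier ?R" if "u \<in> ?L" for u
    using R.a_closed[OF Var_in_mpoly_ring uminus_in_mpoly_ring[OF two], of u] that
    by (simp add: a_def)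
  have prod_in: "(\<Prod>u\<in>I. a u) \<in> carrier ?R" if "I \<subseteq> ?L" for I
    using finite_subset[OF that \<open>finite ?L\<close>] that
    by (induction I rule: finite_induct) (use one a_in R.m_closed in auto)
  have "2 * y + - 1 \<in> carrier ?R"
    using R.a_closed[OF R.m_closed[OF two y_in] m1] by simp
  then have gens_in: "?gens \<subseteq> carrier ?R"
    unfolding C_eq D_eq using prod_in R.m_closed[of "2 * y - 1"] by auto

  have minors_sub: "?minors \<subseteq> Idl\<^bsub>?R\<^esub> ?gens"
  proof
    fix d assume "d \<in> ?minors"
    then obtain rs cs where d: "d = det (mat k k (\<lambda>(i, j). gen_dist_matrix G (rs ! i) (cs ! j)))"
      and rs: "distinct rs" "set rs \<subseteq> ?V" "length rs = k"
      and cs: "distinct cs" "set cs \<subseteq> ?V" "length cs = k"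
      unfolding dist_minors_def by blast
    interpret I: ideal "Idl\<^bsub>?R\<^esub> ?gens" ?R
      using gens_in by (rule R.genideal_ideal)
    note self = R.genideal_self[OF gens_in]
    have sub: "(!) rs ` {..<k} \<inter> (!) cs ` {..<k} - {center} \<subseteq> ?L"
      using rs by (auto dest: nth_mem)
    \<comment> \<open>The collected factor starts at 1, and \<open>B\<close> is the set of all
      leaves.\<close>
    have "1 * index_minor ?E k ((!) rs) ((!) cs) \<in> Idl\<^bsub>?R\<^esub> ?gens"
    proof (rule mult_index_minor_star_mem[where S = "carrier ?R" and B = ?L])
      show "0 \<in> Idl\<^bsub>?R\<^esub> ?gens" using I.zero_closed by simp
      show "p + q \<in> Idl\<^bsub>?R\<^esub> ?gens" if "p \<in> Idl\<^bsub>?R\<^esub> ?gens" "q \<in> Idl\<^bsub>?R\<^esub> ?gens" for p q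
        using I.a_closed[OF that] by simp
      show "p * q \<in> Idl\<^bsub>?R\<^esub> ?gens" if "p \<in> carrier ?R" "q \<in> Idl\<^bsub>?R\<^esub> ?gens" for p q
        using I.I_l_closed[OF that(2,1)] by simp
      show "inj_on ((!) rs) {..<k}" "inj_on ((!) cs) {..<k}"
        using rs cs by (auto intro!: inj_on_nth)
      show "2 + a u \<in> carrier ?R"
        if "u \<in> (!) rs ` {..<k} \<inter> (!) cs ` {..<k} - {center}" for u
        using R.a_closed[OF two a_in] that sub by auto
      show "1 * (\<Prod>u\<in>I. a u) \<in> Idl\<^bsub>?R\<^esub> ?gens"
        if "I \<subseteq> (!) rs ` {..<k} \<inter> (!) cs ` {..<k} - {center}" "card I + 1 = k" for I
      proof -
        have "(\<Prod>u\<in>I. a u) \<in> ?gens" unfolding C_eq using that sub by blast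
        then show ?thesis using self by auto
      qed
      show "1 * ((2 * y - 1) * (\<Prod>u\<in>I. a u)) \<in> Idl\<^bsub>?R\<^esub> ?gens"
        if "I \<subseteq> (!) rs ` {..<k} \<inter> (!) cs ` {..<k} - {center}" "card I + 2 = k" for I
      proof -
        have "(2 * y - 1) * (\<Prod>u\<in>I. a u) \<in> ?gens" unfolding D_eq using that sub by blast
        then show ?thesis using self by auto
      qed
    qed (use sub one m1 two y_in k \<open>finite ?L\<close> in auto)
    then show "d \<in> Idl\<^bsub>?R\<^esub> ?gens"
      unfolding d using minor rs cs by simp
  qed
  then have minors_in: "?minors \<subseteq> carrier ?R"
    using additive_subgroup.a_subset[OF ideal.axioms(1)[OF R.genideal_ideal[OF gens_in]]] by blast

  \<comment> \<open>For the other inclusion of ideals it suffices that every generator is itself a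
    minor.\<close>
  have "?gens \<subseteq> ?minors"
  proof
    fix p assume "p \<in> ?gens"
    then consider
      I where "I \<subseteq> ?L" "card I + 1 = k" "p = (\<Prod>u\<in>I. a u)"
      | I where "I \<subseteq> ?L" "card I + 2 = k" "p = (2 * y - 1) * (\<Prod>u\<in>I. a u)"
      unfolding C_eq D_eq by blast
    then show "p \<in> ?minors"
    proof cases
      case 1
      have "finite I" using 1(1) \<open>finite ?L\<close> by (rule finite_subset)
      then obtain xs where xs: "set xs = I" "distinct xs" using finite_distinct_list by blast
      have len: "length xs + 1 = k" using 1(2) xs distinct_card by fastforce
      \<comment> \<open>Since \<open>I\<close> has \<open>k - 1\<close> elements and
        \<open>k \<le> m\<close>, a leaf \<open>l\<close> outside \<open>I\<close> remains. The
        minor has rows \<open>I\<close> and the center, columns \<open>I\<close> and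
        \<open>l\<close>.\<close>
      have "card I < card ?L" using 1(2) k card_L by simp
      then have "\<not> ?L \<subseteq> I"
        using card_mono[OF \<open>finite I\<close>] linorder_not_le by blast
      then obtain l where l: "l \<in> ?L" "l \<notin> I" by blast
      have "p = index_minor ?E k ((!) (xs @ [center])) ((!) (xs @ [l]))"
        using index_minor_star_C[of xs center l a y] xs l 1 len by auto
      also have "\<dots> = det (mat k k (\<lambda>(i, j). gen_dist_matrix G ((xs @ [center]) ! i) ((xs @ [l]) ! j)))"
        using xs l 1(1) len assms(4) by (intro minor[symmetric]) auto
      finally show ?thesis
        unfolding dist_minors_def
        by (intro CollectI exI[of _ "xs @ [center]"] exI[of _ "xs @ [l]"])
          (use xs l 1(1) len assms(4) in auto)
    next
      case 2
      have "finite I" using 2(1) \<open>finite ?L\<close> by (rule finite_subset)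
      then obtain xs where xs: "set xs = I" "distinct xs" using finite_distinct_list by blast
      have len: "length xs + 2 = k" using 2(2) xs distinct_card by fastforce
      \<comment> \<open>Now \<open>I\<close> has \<open>k - 2\<close> elements, so
        \<open>k \<le> m\<close> leaves two further leaves: \<open>l\<close> for the extra row,
        \<open>l'\<close> for the extra column.\<close>
      have "card (?L - I) \<ge> 2"
        using card_Diff_subset[OF \<open>finite I\<close> 2(1)] 2(2) k card_L by simp
      then obtain T where "T \<subseteq> ?L - I" "card T = 2"
        using obtain_subset_with_card_n by metis
      then obtain l l' where l: "l \<in> ?L - I" "l' \<in> ?L - I" "l \<noteq> l'"
        by (auto simp: card_2_iff)
      have "p = index_minor ?E k ((!) (xs @ [center, l])) ((!) (xs @ [center, l']))"
        using index_minor_star_D[of xs center l l' a y] xs l 2 len by auto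
      also have "\<dots> = det (mat k k
          (\<lambda>(i, j). gen_dist_matrix G ((xs @ [center, l]) ! i) ((xs @ [center, l']) ! j)))"
        using xs l 2(1) len assms(4) by (intro minor[symmetric]) auto
      finally show ?thesis
        unfolding dist_minors_def
        by (intro CollectI exI[of _ "xs @ [center, l]"] exI[of _ "xs @ [center, l']"])
          (use xs l 2(1) len assms(4) in auto)
    qed
  qed
  then have "?gens \<subseteq> Idl\<^bsub>?R\<^esub> ?minors"
    using R.genideal_self[OF minors_in] by blast
  with minors_sub show ?thesis
    unfolding distance_ideal_def
    by (intro equalityI R.genideal_minimal R.genideal_ideal gens_in minors_in)
qed

end
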